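(* Let $K \in \mathcal{B}(\mathcal{H}_n)$ be a positive operator. Then $\widetilde{\mathbb{O}}_{1} = \dfrac{\operatorname{tr}(K)}{N}$. Moreover, an $(N,n)$ $K$-dual pair $(F,G)$, $F=\{f_i\}_{i=1}^N$, $G=\{g_i\}_{i=1}^N$, is a $1$-erasure optimal $K$-dual pair with respect to the operator norm if and only if $\|f_i\|\,\|g_i\| = \dfrac{\operatorname{tr}(K)}{N}$ for all $1 \leq i \leq N$.
   Context: $\mathcal{H}_n$ is an $n$-dimensional Hilbert space (over $\mathbb{R}$ or $\mathbb{C}$), $\mathcal{B}(\mathcal{H}_n)$ is the algebra of bounded linear operators on it, and $N \geq n$ is a fixed integer. For $K\in\mathcal{B}(\mathcal{H}_n)$, a sequence $F=\{f_i\}_{i=1}^N\subset\mathcal{H}_n$ is a $K$-frame if there are constants $0<A\le B<\infty$ with $A\|K^*f\|^2\le\sum_{i=1}^N|\langle f,f_i\rangle|^2\le B\|f\|^2$ for all $f\in\mathcal{H}_n$. A sequence $G=\{g_i\}_{i=1}^N\subset\mathcal{H}_n$ is a $K$-dual of the $K$-frame $F$ if $Kf=\sum_{i=1}^N\langle f,g_i\rangle f_i$ for all $f\in\mathcal{H}_n$ (equivalently $K^*f=\sum_{i=1}^N\langle f,f_i\rangle g_i$ for all $f$, i.e. $F$ is a $K^*$-dual of $G$). In this case $(F,G)$ is called an $(N,n)$ $K$-dual pair for $\mathcal{H}_n$. For a $K$-dual pair $(F,G)$, $\mathbb{O}_1(F,G)$ denotes the maximum over $1\le i\le N$ of the operator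 norm of the error operator $f\mapsto\langle f,f_i\rangle g_i$, i.e. $\mathbb{O}_1(F,G)=\max_{1\le i\le N}\|f_i\|\,\|g_i\|$. Set $\widetilde{\mathbb{O}}_1:=\inf\{\mathbb{O}_1(F,G):(F,G)\text{ is an }(N,n)\ K\text{-dual pair for }\mathcal{H}_n\}$. A $K$-dual pair $(F',G')$ is $1$-erasure optimal with respect to the operator norm if $\mathbb{O}_1(F',G')=\widetilde{\mathbb{O}}_1$. *)

theory Defs
  imports "HOL-Analysis.Analysis"
begin

text \<open>
  The scalar field, real or complex. Every type of this class is isomorphic to \<open>\<real>\<close> or \<open>\<complex>\<close> with its
  usual conjugation: the second axiom, applied to \<open>x\<close> and to \<open>1 + x\<close>, shows that both \<open>x * conjg x\<close> and
  \<open>x + conjg x\<close> are real, so every \<open>x\<close> is a root of a quadratic polynomial with real coefficients.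
\<close>

class rc_field = real_normed_field +
  fixes conjg :: "'a \<Rightarrow> 'a"
  assumes conjg_add: "conjg (x + y) = conjg x + conjg y"
    and mult_conjg: "x * conjg x = scaleR ((norm x)\<^sup>2) 1"

instantiation real :: rc_field
begin
definition conjg_real :: "real \<Rightarrow> real" where "conjg_real x = x"
instance by standard (simp_all add: conjg_real_def power2_eq_square)
end

instantiation complex :: rc_field
begin
definition conjg_complex :: "complex \<Rightarrow> complex" where "conjg_complex z = cnj z"
instance
proof
  fix x y :: complex
  show "conjg (x + y) = conjg x + conjg y"
    by (simp add: conjg_complex_def)
  show "x * conjg x = scaleR ((norm x)\<^sup>2) 1"
    unfolding conjg_complex_def scaleR_conv_of_real mult_1_right by (rule complex_norm_square [symmetric])
qed
end

text \<open>The inner product is linear in the first and conjugate-linear in the second argument.\<close>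

locale inner_product_space = vector_space smul
  for smul :: "'k::rc_field \<Rightarrow> 'v::ab_group_add \<Rightarrow> 'v" +
  fixes ip :: "'v \<Rightarrow> 'v \<Rightarrow> 'k"
  assumes ip_add_left: "ip (x + y) z = ip x z + ip y z"
    and ip_smul_left: "ip (smul c x) y = c * ip x y"
    and ip_commute: "ip y x = conjg (ip x y)"
    and ip_self_nonneg: "\<exists>r\<ge>0. ip x x = of_real r"
    and ip_self_eq_0: "ip x x = 0 \<Longrightarrow> x = 0"

definition is_basis :: "('k::rc_field \<Rightarrow> 'v::ab_group_add \<Rightarrow> 'v) \<Rightarrow> 'v set \<Rightarrow> bool" where
  "is_basis smul B \<longleftrightarrow> \<not> module.dependent smul B \<and> module.span smul B = UNIV"

text \<open>Completeness need not be required: it is automatic in finite dimension.\<close>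

locale hilbert_space_dim = inner_product_space smul ip
  for smul :: "'k::rc_field \<Rightarrow> 'v::ab_group_add \<Rightarrow> 'v" and ip :: "'v \<Rightarrow> 'v \<Rightarrow> 'k" +
  fixes n :: nat
  assumes dimension: "\<exists>B. is_basis smul B \<and> finite B \<and> card B = n"

lemma hilbert_space_dim_euclidean:
  "hilbert_space_dim (scaleR :: real \<Rightarrow> 'a::euclidean_space \<Rightarrow> 'a) inner DIM('a)"
proof unfold_locales
  show "\<exists>B::'a set. is_basis scaleR B \<and> finite B \<and> card B = DIM('a)"
    by (intro exI[of _ Basis])
       (auto simp: is_basis_def independent_Basis span_Basis simp flip: dependent_raw_def span_raw_def)
qed (auto simp: conjg_real_def inner_commute algebra_simps)

lemma hilbert_space_dim_complex_vec:
  "hilbert_space_dim ((*s) :: complex \<Rightarrow> complex^'n \<Rightarrow> complex^'n)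
     (\<lambda>x y. \<Sum>i\<in>UNIV. x $ i * cnj (y $ i)) CARD('n)"
proof unfold_locales
  fix x y z :: "complex^'n" and c :: complex
  show "(\<Sum>i\<in>UNIV. (x + y) $ i * cnj (z $ i)) =
      (\<Sum>i\<in>UNIV. x $ i * cnj (z $ i)) + (\<Sum>i\<in>UNIV. y $ i * cnj (z $ i))"
    by (simp add: algebra_simps sum.distrib)
  show "(\<Sum>i\<in>UNIV. (c *s x) $ i * cnj (y $ i)) = c * (\<Sum>i\<in>UNIV. x $ i * cnj (y $ i))"
    by (simp add: sum_distrib_left mult.assoc)
  show "(\<Sum>i\<in>UNIV. y $ i * cnj (x $ i)) = conjg (\<Sum>i\<in>UNIV. x $ i * cnj (y $ i))"
    by (simp add: conjg_complex_def mult.commute)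
  have sq: "(\<Sum>i\<in>UNIV. x $ i * cnj (x $ i)) = of_real (\<Sum>i\<in>UNIV. (norm (x $ i))\<^sup>2)"
    by (simp flip: complex_norm_square)
  show "\<exists>r\<ge>0. (\<Sum>i\<in>UNIV. x $ i * cnj (x $ i)) = of_real r"
    unfolding sq by (intro exI[of _ "\<Sum>i\<in>UNIV. (norm (x $ i))\<^sup>2"]) (simp add: sum_nonneg)
  show "x = 0" if "(\<Sum>i\<in>UNIV. x $ i * cnj (x $ i)) = 0"
  proof -
    have "(\<Sum>i\<in>UNIV. (norm (x $ i))\<^sup>2) = 0"
      using that unfolding sq of_real_eq_0_iff .
    then show ?thesis
      by (simp add: sum_nonneg_eq_0_iff vec_eq_iff)
  qed
next
  show "\<exists>B::(complex^'n) set. is_basis (*s) B \<and> finite B \<and> card B = CARD('n)"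
    using vec.independent_Basis vec.span_Basis finite_cart_basis card_cart_basis
    unfolding is_basis_def by blast
qed

definition vnorm :: "('v \<Rightarrow> 'v \<Rightarrow> 'k::rc_field) \<Rightarrow> 'v \<Rightarrow> real" where
  "vnorm ip x = sqrt (norm (ip x x))"

definition bounded_op ::
  "('k::rc_field \<Rightarrow> 'v::ab_group_add \<Rightarrow> 'v) \<Rightarrow> ('v \<Rightarrow> 'v \<Rightarrow> 'k) \<Rightarrow> ('v \<Rightarrow> 'v) \<Rightarrow> bool" where
  "bounded_op smul ip T \<longleftrightarrow>
     Vector_Spaces.linear smul smul T \<and> (\<exists>C. \<forall>x. vnorm ip (T x) \<le> C * vnorm ip x)"

text \<open>As in \<open>onorm\<close>, the quotient is \<open>0\<close> at \<open>x = 0\<close>.\<close>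

definition op_norm :: "('v \<Rightarrow> 'v \<Rightarrow> 'k::rc_field) \<Rightarrow> ('v \<Rightarrow> 'v) \<Rightarrow> real" where
  "op_norm ip T = (SUP x. vnorm ip (T x) / vnorm ip x)"

definition adj :: "('v \<Rightarrow> 'v \<Rightarrow> 'k::rc_field) \<Rightarrow> ('v \<Rightarrow> 'v) \<Rightarrow> ('v \<Rightarrow> 'v)" where
  "adj ip T = (SOME S. \<forall>x y. ip (T x) y = ip x (S y))"

text \<open>Self-adjointness is required explicitly because it is not automatic over the reals.\<close>

definition positive_op ::
  "('k::rc_field \<Rightarrow> 'v::ab_group_add \<Rightarrow> 'v) \<Rightarrow> ('v \<Rightarrow> 'v \<Rightarrow> 'k) \<Rightarrow> ('v \<Rightarrow> 'v) \<Rightarrow> bool" where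
  "positive_op smul ip T \<longleftrightarrow>
     bounded_op smul ip T \<and> adj ip T = T \<and> (\<forall>x. \<exists>r\<ge>0. ip (T x) x = of_real r)"

text \<open>The sum of the diagonal entries of the matrix of \<open>T\<close> with respect to some basis.\<close>

definition op_trace :: "('k::rc_field \<Rightarrow> 'v::ab_group_add \<Rightarrow> 'v) \<Rightarrow> ('v \<Rightarrow> 'v) \<Rightarrow> 'k" where
  "op_trace smul T =
     (let B = (SOME B. is_basis smul B) in \<Sum>b\<in>B. module.representation smul B (T b) b)"

text \<open>
  A sequence \<open>f\<^sub>1, \<dots>, f\<^sub>N\<close> is a function on \<^typ>\<open>nat\<close> of which only the values on \<open>{1..N}\<close> are used.
\<close>

definition K_frame ::
  "('v \<Rightarrow> 'v \<Rightarrow> 'k::rc_field) \<Rightarrow> ('v \<Rightarrow> 'v) \<Rightarrow> nat \<Rightarrow> (nat \<Rightarrow> 'v) \<Rightarrow> bool" where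
  "K_frame ip K N F \<longleftrightarrow> (\<exists>A B. 0 < A \<and> A \<le> B \<and>
     (\<forall>f. A * (vnorm ip (adj ip K f))\<^sup>2 \<le> (\<Sum>i=1..N. (norm (ip f (F i)))\<^sup>2) \<and>
          (\<Sum>i=1..N. (norm (ip f (F i)))\<^sup>2) \<le> B * (vnorm ip f)\<^sup>2))"

definition K_dual_pair ::
  "('k::rc_field \<Rightarrow> 'v::ab_group_add \<Rightarrow> 'v) \<Rightarrow> ('v \<Rightarrow> 'v \<Rightarrow> 'k) \<Rightarrow> ('v \<Rightarrow> 'v) \<Rightarrow> nat
     \<Rightarrow> (nat \<Rightarrow> 'v) \<Rightarrow> (nat \<Rightarrow> 'v) \<Rightarrow> bool" where
  "K_dual_pair smul ip K N F G \<longleftrightarrow>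
     K_frame ip K N F \<and> (\<forall>f. K f = (\<Sum>i=1..N. smul (ip f (G i)) (F i)))"

definition erasure_error ::
  "('k::rc_field \<Rightarrow> 'v::ab_group_add \<Rightarrow> 'v) \<Rightarrow> ('v \<Rightarrow> 'v \<Rightarrow> 'k) \<Rightarrow> nat
     \<Rightarrow> (nat \<Rightarrow> 'v) \<Rightarrow> (nat \<Rightarrow> 'v) \<Rightarrow> real" where
  "erasure_error smul ip N F G =
     Max ((\<lambda>i. op_norm ip (\<lambda>f. smul (ip f (F i)) (G i))) ` {1..N})"

definition min_erasure_error ::
  "('k::rc_field \<Rightarrow> 'v::ab_group_add \<Rightarrow> 'v) \<Rightarrow> ('v \<Rightarrow> 'v \<Rightarrow> 'k) \<Rightarrow> ('v \<Rightarrow> 'v) \<Rightarrow> nat \<Rightarrow> real" where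
  "min_erasure_error smul ip K N =
     Inf {erasure_error smul ip N F G | F G. K_dual_pair smul ip K N F G}"

definition erasure_optimal ::
  "('k::rc_field \<Rightarrow> 'v::ab_group_add \<Rightarrow> 'v) \<Rightarrow> ('v \<Rightarrow> 'v \<Rightarrow> 'k) \<Rightarrow> ('v \<Rightarrow> 'v) \<Rightarrow> nat
     \<Rightarrow> (nat \<Rightarrow> 'v) \<Rightarrow> (nat \<Rightarrow> 'v) \<Rightarrow> bool" where
  "erasure_optimal smul ip K N F G \<longleftrightarrow>
     K_dual_pair smul ip K N F G \<and>
     erasure_error smul ip N F G = min_erasure_error smul ip K N"

end

theory Submission imports Defs begin

text \<open>
  The value \<open>tr K / N\<close> is a lower bound because the trace of \<open>K\<close> can be read off any dual pair: from
  \<open>K f = \<Sum>\<^sub>i \<langle>f, g\<^sub>i\<rangle> f\<^sub>i\<close> it follows that \<open>tr K = \<Sum>\<^sub>i \<langle>f\<^sub>i, g\<^sub>i\<rangle>\<close> (\<open>op_trace_dual_pair\<close>), so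
  Cauchy-Schwarz gives \<open>tr K \<le> \<Sum>\<^sub>i \<parallel>f\<^sub>i\<parallel> \<parallel>g\<^sub>i\<parallel>\<close>, and the largest of the \<open>N\<close> summands is at least
  \<open>tr K / N\<close>. It equals \<open>tr K / N\<close> exactly when all the summands do.

  The bound is attained because a positive \<open>K\<close> is a sum of \<open>N\<close> rank-one operators
  \<open>\<langle>\<cdot>, h\<^sub>i\<rangle> h\<^sub>i\<close> with vectors of equal length; then \<open>(h, h)\<close> is an optimal pair. This decomposition is
  found in two stages. Elimination in the style of Cholesky writes \<open>K\<close> as a sum of \<open>N \<ge> n\<close>
  rank-one operators, with no control over the lengths (\<open>psd_rank_one_sum\<close>). The lengths are then made
  equal (\<open>equal_norm_rank_one_sum\<close>) by plane rotations: replacing two of the vectors \<open>a, b\<close> by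
  \<open>cos \<theta> a + sin \<theta> b\<close> and \<open>cos \<theta> b - sin \<theta> a\<close> does not change the operator, and the intermediate value
  theorem provides an angle for which the first new vector has any prescribed length between those of
  \<open>a\<close> and \<open>b\<close>. Choosing \<open>a\<close> no longer and \<open>b\<close> no shorter than the quadratic mean of all
  lengths, rotating \<open>a\<close> to that mean, and repeating with the remaining vectors makes all lengths equal.
\<close>

section \<open>Conjugation\<close>

text \<open>
  The axiom \<open>mult_conjg\<close> determines the conjugation, \<open>conjg x = \<bar>x\<bar>\<^sup>2 / x\<close> for \<open>x \<noteq> 0\<close>; all
  multiplicative rules are read off this formula.
\<close>

lemma conjg_0 [simp]: "conjg (0::'k::rc_field) = 0"
  using conjg_add[of "0::'k" 0] by simp

lemma conjg_eq_divide: "conjg x = of_real ((norm x)\<^sup>2) / x" for x :: "'k::rc_field"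
proof (cases "x = 0")
  case False
  then show ?thesis
    using mult_conjg[of x] by (simp add: field_simps scaleR_conv_of_real)
qed simp

lemma norm_conjg [simp]: "norm (conjg x) = norm x" for x :: "'k::rc_field"
  by (simp add: conjg_eq_divide norm_divide norm_mult power2_eq_square)

lemma conjg_conjg [simp]: "conjg (conjg x) = x" for x :: "'k::rc_field"
proof (cases "x = 0")
  case False
  have "conjg (conjg x) = of_real ((norm x)\<^sup>2) / conjg x"
    by (simp add: conjg_eq_divide[of "conjg x"])
  also have "\<dots> = x"
    using False by (simp add: conjg_eq_divide[of x])
  finally show ?thesis .
qed simp

lemma conjg_mult: "conjg (x * y) = conjg x * conjg y" for x y :: "'k::rc_field"
  by (simp add: conjg_eq_divide norm_mult power_mult_distrib)

lemma conjg_of_real [simp]: "conjg (of_real r :: 'k::rc_field) = of_real r"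
  by (cases "r = 0") (simp_all add: conjg_eq_divide power2_eq_square)

lemma mult_conjg_of_real: "x * conjg x = of_real ((norm x)\<^sup>2)" for x :: "'k::rc_field"
  by (simp add: mult_conjg scaleR_conv_of_real)


section \<open>Positive semidefinite forms\<close>

text \<open>
  Definiteness is dropped so that Cauchy-Schwarz covers both the inner product and the form
  \<open>\<langle>K x, y\<rangle>\<close> of a positive operator \<open>K\<close>.
\<close>

locale semidefinite_form = vector_space smul
  for smul :: "'k::rc_field \<Rightarrow> 'v::ab_group_add \<Rightarrow> 'v" +
  fixes form :: "'v \<Rightarrow> 'v \<Rightarrow> 'k"
  assumes add_left: "form (x + y) z = form x z + form y z"
    and smul_left: "form (smul c x) y = c * form x y"
    and commute: "form y x = conjg (form x y)"
    and self_nonneg: "\<exists>r\<ge>0. form x x = of_real r"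
begin

lemma add_right: "form x (y + z) = form x y + form x z"
  by (metis add_left commute conjg_add)

lemma smul_right: "form x (smul c y) = conjg c * form x y"
  by (metis smul_left commute conjg_mult)

lemma zero_left [simp]: "form 0 y = 0"
  using add_left[of 0 0 y] by simp

lemma zero_right [simp]: "form x 0 = 0"
  using add_right[of x 0 0] by simp

lemma minus_left: "form (- x) y = - form x y"
  using add_left[of x "- x" y] by (simp add: eq_neg_iff_add_eq_0 add.commute)

lemma minus_right: "form x (- y) = - form x y"
  using add_right[of x y "- y"] by (simp add: eq_neg_iff_add_eq_0 add.commute)

lemma diff_left: "form (x - y) z = form x z - form y z"
  using add_left[of x "- y" z] by (simp add: minus_left)

lemma diff_right: "form x (y - z) = form x y - form x z"
  using add_right[of x y "- z"] by (simp add: minus_right)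

lemma sum_left: "form (sum f A) z = (\<Sum>i\<in>A. form (f i) z)"
  by (induction A rule: infinite_finite_induct) (simp_all add: add_left)

lemma self_eq_norm: "form x x = of_real (norm (form x x))"
  using self_nonneg[of x] by auto

lemma Cauchy_Schwarz: "(norm (form x y))\<^sup>2 \<le> norm (form x x) * norm (form y y)"
proof -
  define c where "c = form x y"
  define p where "p = norm (form x x)"
  define q where "q = norm (form y y)"
  have yx: "form y x = conjg c"
    by (metis commute c_def)
  have quadratic: "0 \<le> p - 2 * t * (norm c)\<^sup>2 + t\<^sup>2 * (norm c)\<^sup>2 * q" for t :: real
  proof -
    define z where "z = x - smul (of_real t * c) y"
    have "form z z = form x x - of_real (2 * t) * (c * conjg c)
        + of_real (t\<^sup>2) * (c * conjg c) * form y y"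
      unfolding z_def
      by (simp add: diff_left diff_right smul_left smul_right conjg_mult yx flip: c_def)
        (simp add: algebra_simps power2_eq_square)
    also have "\<dots> = of_real (p - 2 * t * (norm c)\<^sup>2 + t\<^sup>2 * (norm c)\<^sup>2 * q)"
      unfolding mult_conjg_of_real
      by (subst self_eq_norm[of x], subst self_eq_norm[of y]) (simp add: p_def q_def)
    finally show ?thesis
      using self_nonneg[of z] by (metis of_real_eq_iff)
  qed
  have "(norm c)\<^sup>2 \<le> p * q"
  proof (cases "q = 0")
    case True
    have "c = 0"
    proof (rule ccontr)
      assume "c \<noteq> 0"
      \<comment> \<open>For \<open>q = 0\<close> the quadratic is affine in \<open>t\<close>; this \<open>t\<close> makes it equal to \<open>- 1\<close>.\<close>
      then show False
        using quadratic[of "(p + 1) / (2 * (norm c)\<^sup>2)"] True by (simp add: field_simps)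
    qed
    then show ?thesis
      by (simp add: True)
  next
    case False
    then have "q > 0"
      by (simp add: q_def)
    then show ?thesis
      using quadratic[of "1 / q"] by (simp add: field_simps power2_eq_square)
  qed
  then show ?thesis
    by (simp add: c_def p_def q_def)
qed

end

sublocale inner_product_space \<subseteq> semidefinite_form smul ip
  by unfold_locales (rule ip_add_left ip_smul_left ip_commute ip_self_nonneg)+


section \<open>Inner product spaces\<close>

lemma vector_space_mult: "vector_space ((*) :: 'k::field \<Rightarrow> 'k \<Rightarrow> 'k)"
  by unfold_locales (simp_all add: algebra_simps)

context inner_product_space
begin

lemma vnorm_nonneg [simp]: "0 \<le> vnorm ip x"
  by (simp add: vnorm_def)

lemma vnorm_sq: "(vnorm ip x)\<^sup>2 = norm (ip x x)"
  by (simp add: vnorm_def)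

lemma ip_self: "ip x x = of_real ((vnorm ip x)\<^sup>2)"
  unfolding vnorm_sq by (rule self_eq_norm)

lemma vnorm_eq_0_iff [simp]: "vnorm ip x = 0 \<longleftrightarrow> x = 0"
  by (auto simp: vnorm_def intro: ip_self_eq_0)

lemma norm_ip_le: "norm (ip x y) \<le> vnorm ip x * vnorm ip y"
  by (rule power2_le_imp_le) (simp_all add: power_mult_distrib vnorm_sq Cauchy_Schwarz)

lemma vnorm_smul: "vnorm ip (smul c x) = norm c * vnorm ip x"
proof -
  have "norm (ip (smul c x) (smul c x)) = (norm c)\<^sup>2 * norm (ip x x)"
    by (simp add: smul_left smul_right norm_mult power2_eq_square mult.assoc)
  then show ?thesis
    by (simp add: vnorm_def real_sqrt_mult)
qed

lemma eq_if_ip_eq: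
  assumes "\<And>z. ip x z = ip y z"
  shows "x = y"
proof -
  have "ip (x - y) (x - y) = 0"
    unfolding diff_left using assms[of "x - y"] by (simp only: cancel_comm_monoid_add_class.diff_cancel)
  from ip_self_eq_0[OF this] show ?thesis
    by simp
qed

lemma op_norm_rank_one: "op_norm ip (\<lambda>x. smul (ip x f) g) = vnorm ip f * vnorm ip g"
  unfolding op_norm_def
proof (rule cSup_eq_maximum)
  have "vnorm ip (smul (ip f f) g) / vnorm ip f = vnorm ip f * vnorm ip g"
    by (cases "f = 0") (simp_all add: vnorm_smul ip_self power2_eq_square norm_mult)
  then show "vnorm ip f * vnorm ip g \<in> range (\<lambda>x. vnorm ip (smul (ip x f) g) / vnorm ip x)"
    by (intro range_eqI[of _ _ f]) (rule sym)
next
  fix r assume "r \<in> range (\<lambda>x. vnorm ip (smul (ip x f) g) / vnorm ip x)"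
  then obtain x where r: "r = norm (ip x f) * vnorm ip g / vnorm ip x"
    by (auto simp: vnorm_smul)
  show "r \<le> vnorm ip f * vnorm ip g"
  proof (cases "x = 0")
    case False
    then have "vnorm ip x > 0"
      using vnorm_nonneg[of x] by (simp add: less_le)
    then show ?thesis
      using mult_right_mono[OF norm_ip_le[of x f] vnorm_nonneg[of g]]
      by (simp add: r field_simps)
  qed (simp add: r)
qed

text \<open>
  The representing vector is built one generator at a time. A new generator \<open>b\<close> contributes its
  component \<open>u\<close> orthogonal to the previous span, which exists by the induction hypothesis for the
  functional \<open>\<langle>\<cdot>, b\<rangle>\<close>.
\<close>

lemma Riesz_on_span:
  assumes "finite S" "Vector_Spaces.linear smul (*) \<phi>"
  shows "\<exists>y\<in>span S. \<forall>x\<in>span S. \<phi> x = ip x y"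
  using assms
proof (induction S arbitrary: \<phi> rule: finite_induct)
  case empty
  interpret \<phi>: Vector_Spaces.linear smul "(*)" \<phi> by fact
  show ?case
    by (simp add: \<phi>.zero)
next
  case (insert b S)
  interpret \<phi>: Vector_Spaces.linear smul "(*)" \<phi> by fact
  have "Vector_Spaces.linear smul (*) (\<lambda>x. ip x b)"
    by (rule Vector_Spaces.linear.intro[OF vector_space_axioms vector_space_mult])
       (unfold_locales, simp_all add: add_left smul_left)
  from insert.IH[OF this] obtain p where p: "p \<in> span S" "\<And>x. x \<in> span S \<Longrightarrow> ip x b = ip x p"
    by blast
  from insert.IH[OF insert.prems] obtain y
    where y: "y \<in> span S" "\<And>x. x \<in> span S \<Longrightarrow> \<phi> x = ip x y"
    by blast
  define u where "u = b - p"
  have orth: "ip x u = 0" if "x \<in> span S" for x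
    using p(2)[OF that] by (simp add: u_def diff_right)
  have orth': "ip u x = 0" if "x \<in> span S" for x
    using orth[OF that] commute[of u x] by simp
  \<comment> \<open>The second summand is fitted to the value \<open>\<phi> u\<close>; for \<open>u = 0\<close> it vanishes.\<close>
  define z where "z = y + smul (conjg (\<phi> u / ip u u)) u"
  have "p \<in> span (insert b S)" "y \<in> span (insert b S)"
    using p(1) y(1) span_mono[of S "insert b S"] by auto
  then have "z \<in> span (insert b S)"
    unfolding z_def u_def by (intro span_add span_scale span_diff) (auto intro: span_base)
  moreover have "\<phi> x = ip x z" if "x \<in> span (insert b S)" for x
  proof -
    from that obtain k where "x - smul k b \<in> span S"
      using span_breakdown_eq by blast
    then have s: "x - smul k u \<in> span S" (is "?s \<in> _")
      using span_add[OF _ span_scale[OF p(1), of k]]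
      by (metis (no_types, lifting) u_def add_diff_eq diff_diff_eq2 scale_right_diff_distrib diff_add_eq)
    have x: "x = ?s + smul k u"
      by simp
    have "\<phi> x = \<phi> ?s + k * \<phi> u"
      by (subst x) (simp only: \<phi>.add \<phi>.scale)
    also have "k * \<phi> u = k * (\<phi> u / ip u u) * ip u u"
      using ip_self_eq_0[of u] by (cases "u = 0") (auto simp: \<phi>.zero)
    also have "\<phi> ?s + \<dots> = ip ?s z + ip (smul k u) z"
      unfolding z_def add_right smul_right
      by (simp only: y(2)[OF s] orth[OF s] smul_left orth'[OF y(1)]) simp
    also have "\<dots> = ip x z"
      by (metis add_left x)
    finally show ?thesis .
  qed
  ultimately show ?case
    by blast
qed


section \<open>Elimination for positive operators\<close>

text \<open>
  In contrast to \<open>positive_op\<close>, self-adjointness is stated as an identity, without a choice of adjoint,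
  so that it can be verified directly for the operators that remain after an elimination step.
\<close>

definition psd :: "('v \<Rightarrow> 'v) \<Rightarrow> bool" where
  "psd T \<longleftrightarrow> Vector_Spaces.linear smul smul T \<and> (\<forall>x y. ip (T x) y = ip x (T y))
     \<and> (\<forall>x. \<exists>r\<ge>0. ip (T x) x = of_real r)"

lemma psd_form:
  assumes "psd T"
  shows "semidefinite_form smul (\<lambda>x y. ip (T x) y)"
proof -
  interpret T: Vector_Spaces.linear smul smul T
    using assms by (simp add: psd_def)
  show ?thesis
  proof unfold_locales
    fix x y
    show "ip (T y) x = conjg (ip (T x) y)"
      using assms commute[of "T y" x] by (simp add: psd_def)
    show "\<exists>r\<ge>0. ip (T x) x = of_real r"
      using assms unfolding psd_def by blast
  qed (simp_all add: T.add T.scale add_left smul_left)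
qed

lemma psd_eq_0:
  assumes "psd T" "ip (T x) x = 0"
  shows "T x = 0"
proof -
  interpret T: semidefinite_form smul "\<lambda>x y. ip (T x) y"
    by (rule psd_form) fact
  have "ip (T x) (T x) = 0"
    using T.Cauchy_Schwarz[of x "T x"] assms(2) by simp
  then show ?thesis
    by (rule ip_self_eq_0)
qed

text \<open>
  One elimination step: the rank-one operator with vector \<open>T b / \<surd>\<langle>T b, b\<rangle>\<close> agrees with \<open>T\<close> at
  \<open>b\<close>, and positivity of the difference is Cauchy-Schwarz for the form \<open>\<langle>T x, y\<rangle>\<close>. Vectors that \<open>T\<close>
  annihilates are orthogonal to \<open>T b\<close>, so they are still annihilated afterwards.
\<close>

lemma psd_elimination:
  assumes T: "psd T"
  obtains h where "psd (\<lambda>x. T x - smul (ip x h) h)" "T b - smul (ip b h) h = 0"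
    "\<And>x. T x = 0 \<Longrightarrow> T x - smul (ip x h) h = 0"
proof -
  interpret T: Vector_Spaces.linear smul smul T
    using T by (simp add: psd_def)
  interpret form: semidefinite_form smul "\<lambda>x y. ip (T x) y"
    by (rule psd_form) fact
  have herm: "ip (T x) y = ip x (T y)" for x y
    using T by (simp add: psd_def)
  obtain r where r: "r \<ge> 0" "ip (T b) b = of_real r"
    using form.self_nonneg by blast
  \<comment> \<open>If \<open>r = 0\<close>, then \<open>T b = 0\<close> by \<open>psd_eq_0\<close>, so \<open>h = 0\<close> and nothing is subtracted.\<close>
  define h where "h = smul (of_real (1 / sqrt r)) (T b)"
  have rank_one: "smul (ip x h) h = smul (of_real (1 / r) * ip x (T b)) (T b)" for x
  proof -
    have "of_real (1 / sqrt r) * of_real (1 / sqrt r) = (of_real (1 / r) :: 'k)"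
      using r(1) unfolding of_real_mult[symmetric] by simp
    then show ?thesis
      by (simp add: h_def smul_right mult.assoc mult.commute mult.left_commute
          del: of_real_divide of_real_1)
  qed
  show thesis
  proof
    show "psd (\<lambda>x. T x - smul (ip x h) h)"
      unfolding psd_def
    proof (intro conjI allI)
      show "Vector_Spaces.linear smul smul (\<lambda>x. T x - smul (ip x h) h)"
        by (rule Vector_Spaces.linear.intro[OF vector_space_axioms vector_space_axioms])
           (unfold_locales, simp_all add: T.add T.scale add_left smul_left
             scale_left_distrib scale_right_diff_distrib)
    next
      fix x y
      show "ip (T x - smul (ip x h) h) y = ip x (T y - smul (ip y h) h)"
        using commute[of y h] by (simp add: diff_left diff_right smul_left smul_right herm)
    next
      fix x
      have "(norm (ip x (T b)))\<^sup>2 \<le> norm (ip (T x) x) * r"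
        using form.Cauchy_Schwarz[of x b] r by (simp add: herm)
      then have "(norm (ip x (T b)))\<^sup>2 / r \<le> norm (ip (T x) x)"
        using r(1) by (cases "r = 0") (simp_all add: field_simps)
      moreover have "ip (T x - smul (ip x h) h) x
          = of_real (norm (ip (T x) x) - (norm (ip x (T b)))\<^sup>2 / r)"
      proof -
        have "ip (T x - smul (ip x h) h) x
            = ip (T x) x - of_real (1 / r) * (ip x (T b) * conjg (ip x (T b)))"
          using commute[of "T b" x] by (simp add: rank_one diff_left smul_left)
        then show ?thesis
          unfolding mult_conjg_of_real by (subst (asm) form.self_eq_norm) simp
      qed
      ultimately show "\<exists>s\<ge>0. ip (T x - smul (ip x h) h) x = of_real s"
        by (intro exI[of _ "norm (ip (T x) x) - (norm (ip x (T b)))\<^sup>2 / r"]) auto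
    qed
  next
    show "T b - smul (ip b h) h = 0"
    proof (cases "r = 0")
      case True
      then show ?thesis
        using psd_eq_0[OF T, of b] r(2) by (simp add: rank_one)
    next
      case False
      then show ?thesis
        unfolding rank_one herm[symmetric] r(2) by simp
    qed
  next
    fix x assume "T x = 0"
    then have "ip x (T b) = 0"
      using herm[of x b] by simp
    then show "T x - smul (ip x h) h = 0"
      using \<open>T x = 0\<close> by (simp add: rank_one)
  qed
qed

lemma psd_elimination_iterated:
  assumes "psd T"
  shows "\<exists>h. psd (\<lambda>x. T x - (\<Sum>i=1..m::nat. smul (ip x (h i)) (h i)))
    \<and> (\<forall>j\<in>{1..m}. T (b j) - (\<Sum>i=1..m. smul (ip (b j) (h i)) (h i)) = 0)"
proof (induction m)
  case 0
  then show ?case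
    using assms by simp
next
  case (Suc m)
  then obtain h where
    psd: "psd (\<lambda>x. T x - (\<Sum>i=1..m. smul (ip x (h i)) (h i)))" and
    zero: "\<And>j. j \<in> {1..m} \<Longrightarrow> T (b j) - (\<Sum>i=1..m. smul (ip (b j) (h i)) (h i)) = 0"
    by blast
  obtain v where v:
    "psd (\<lambda>x. T x - (\<Sum>i=1..m. smul (ip x (h i)) (h i)) - smul (ip x v) v)"
    "T (b (Suc m)) - (\<Sum>i=1..m. smul (ip (b (Suc m)) (h i)) (h i)) - smul (ip (b (Suc m)) v) v = 0"
    "\<And>x. T x - (\<Sum>i=1..m. smul (ip x (h i)) (h i)) = 0 \<Longrightarrow>
      T x - (\<Sum>i=1..m. smul (ip x (h i)) (h i)) - smul (ip x v) v = 0"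
    using psd_elimination[OF psd, of "b (Suc m)"] by blast
  have sum: "(\<Sum>i=1..Suc m. smul (ip x ((h(Suc m := v)) i)) ((h(Suc m := v)) i))
      = (\<Sum>i=1..m. smul (ip x (h i)) (h i)) + smul (ip x v) v" for x
    by (simp add: sum.atLeast1_atMost_eq)
  show ?case
  proof (intro exI[of _ "h(Suc m := v)"] conjI ballI)
    show "psd (\<lambda>x. T x - (\<Sum>i=1..Suc m. smul (ip x ((h(Suc m := v)) i)) ((h(Suc m := v)) i)))"
      unfolding sum using v(1) by (simp add: diff_diff_eq)
  next
    fix j assume "j \<in> {1..Suc m}"
    then consider "j \<in> {1..m}" | "j = Suc m"
      by force
    then show "T (b j) - (\<Sum>i=1..Suc m. smul (ip (b j) ((h(Suc m := v)) i)) ((h(Suc m := v)) i)) = 0"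
      unfolding sum diff_diff_eq[symmetric]
      by cases (use v(2) v(3)[OF zero] in auto)
  qed
qed


section \<open>Equalizing the lengths\<close>

lemma rotate_to_norm:
  assumes "(vnorm ip a)\<^sup>2 \<le> t" "t \<le> (vnorm ip b)\<^sup>2"
  obtains a' b' where "(vnorm ip a')\<^sup>2 = t"
    "(vnorm ip a')\<^sup>2 + (vnorm ip b')\<^sup>2 = (vnorm ip a)\<^sup>2 + (vnorm ip b)\<^sup>2"
    "\<And>x. smul (ip x a') a' + smul (ip x b') b' = smul (ip x a) a + smul (ip x b) b"
proof -
  define q where "q \<theta> = norm (of_real ((cos \<theta>)\<^sup>2) * ip a a + of_real ((sin \<theta>)\<^sup>2) * ip b b
      + of_real (cos \<theta> * sin \<theta>) * (ip a b + ip b a))" for \<theta> :: real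
  have q: "(vnorm ip (smul (of_real (cos \<theta>)) a + smul (of_real (sin \<theta>)) b))\<^sup>2 = q \<theta>" for \<theta>
    unfolding vnorm_sq q_def
    by (rule arg_cong[of _ _ norm])
       (simp add: add_left add_right smul_left smul_right algebra_simps power2_eq_square)
  have "\<exists>\<theta>\<ge>0. \<theta> \<le> pi / 2 \<and> q \<theta> = t"
  proof (rule IVT')
    show "q 0 \<le> t" "t \<le> q (pi / 2)"
      using assms by (simp_all add: q_def vnorm_sq)
    show "continuous_on {0..pi / 2} q"
      unfolding q_def by (intro continuous_intros)
  qed simp
  then obtain \<theta> where \<theta>: "q \<theta> = t"
    by blast
  define c s where "c = (of_real (cos \<theta>) :: 'k)" and "s = (of_real (sin \<theta>) :: 'k)"
  have real: "conjg c = c" "conjg s = s"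
    by (simp_all add: c_def s_def)
  have cs: "c * c + s * s = 1"
    unfolding c_def s_def of_real_mult[symmetric] of_real_add[symmetric]
    by (simp flip: power2_eq_square)
  define a' b' where "a' = smul c a + smul s b" and "b' = smul c b - smul s a"
  have "ip a' a' + ip b' b' = (c * c + s * s) * ip a a + (c * c + s * s) * ip b b"
    unfolding a'_def b'_def
    by (simp add: add_left add_right diff_left diff_right smul_left smul_right real algebra_simps)
  then have "(of_real ((vnorm ip a')\<^sup>2 + (vnorm ip b')\<^sup>2) :: 'k)
      = of_real ((vnorm ip a)\<^sup>2 + (vnorm ip b)\<^sup>2)"
    by (simp only: ip_self cs of_real_add mult_1_left)
  then have "(vnorm ip a')\<^sup>2 + (vnorm ip b')\<^sup>2 = (vnorm ip a)\<^sup>2 + (vnorm ip b)\<^sup>2"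
    by (simp only: of_real_eq_iff)
  moreover have "smul (ip x a') a' + smul (ip x b') b' = smul (ip x a) a + smul (ip x b) b" for x
  proof (rule eq_if_ip_eq)
    fix z
    have "ip (smul (ip x a') a' + smul (ip x b') b') z
        = (c * c + s * s) * (ip x a * ip a z) + (c * c + s * s) * (ip x b * ip b z)"
      unfolding a'_def b'_def
      by (simp add: add_left add_right diff_left diff_right smul_left smul_right real algebra_simps)
    then show "ip (smul (ip x a') a' + smul (ip x b') b') z = ip (smul (ip x a) a + smul (ip x b) b) z"
      by (simp add: cs add_left smul_left)
  qed
  moreover have "(vnorm ip a')\<^sup>2 = t"
    using q[of \<theta>] \<theta> by (simp add: a'_def c_def s_def)
  ultimately show thesis
    by (rule that[rotated])
qed

text \<open>
  Each rotation fixes one vector at the mean value \<open>t\<close>, and the sum of squares over the remaining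
  ones still has mean \<open>t\<close>, so the induction removes one index at a time.
\<close>

lemma equal_norm_rank_one_sum:
  assumes "finite I" "(\<Sum>i\<in>I. (vnorm ip (h i))\<^sup>2) = of_nat (card I) * t"
  shows "\<exists>g. (\<forall>i\<in>I. (vnorm ip (g i))\<^sup>2 = t)
    \<and> (\<forall>x. (\<Sum>i\<in>I. smul (ip x (g i)) (g i)) = (\<Sum>i\<in>I. smul (ip x (h i)) (h i)))"
  using assms
proof (induction "card I" arbitrary: I h)
  case 0
  then show ?case by auto
next
  case (Suc m)
  then have "I \<noteq> {}"
    by auto
  have "\<exists>i\<in>I. (vnorm ip (h i))\<^sup>2 \<le> t"
  proof (rule ccontr)
    assume "\<not> ?thesis"
    then have "(\<Sum>i\<in>I. t) < (\<Sum>i\<in>I. (vnorm ip (h i))\<^sup>2)"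
      using Suc.prems(1) \<open>I \<noteq> {}\<close> by (intro sum_strict_mono) auto
    then show False
      using Suc.prems(2) by simp
  qed
  then obtain i where i: "i \<in> I" "(vnorm ip (h i))\<^sup>2 \<le> t"
    by blast
  have "\<exists>j\<in>I. t \<le> (vnorm ip (h j))\<^sup>2"
  proof (rule ccontr)
    assume "\<not> ?thesis"
    then have "(\<Sum>i\<in>I. (vnorm ip (h i))\<^sup>2) < (\<Sum>i\<in>I. t)"
      using Suc.prems(1) \<open>I \<noteq> {}\<close> by (intro sum_strict_mono) auto
    then show False
      using Suc.prems(2) by simp
  qed
  then obtain j where j: "j \<in> I" "t \<le> (vnorm ip (h j))\<^sup>2"
    by blast
  have "\<exists>k. (vnorm ip (k i))\<^sup>2 = t \<and> (\<Sum>l\<in>I. (vnorm ip (k l))\<^sup>2) = (\<Sum>l\<in>I. (vnorm ip (h l))\<^sup>2)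
    \<and> (\<forall>x. (\<Sum>l\<in>I. smul (ip x (k l)) (k l)) = (\<Sum>l\<in>I. smul (ip x (h l)) (h l)))"
  proof (cases "i = j")
    case True
    then show ?thesis
      using i j by (intro exI[of _ h]) auto
  next
    case False
    obtain a b where ab: "(vnorm ip a)\<^sup>2 = t"
      "(vnorm ip a)\<^sup>2 + (vnorm ip b)\<^sup>2 = (vnorm ip (h i))\<^sup>2 + (vnorm ip (h j))\<^sup>2"
      "\<And>x. smul (ip x a) a + smul (ip x b) b
        = smul (ip x (h i)) (h i) + smul (ip x (h j)) (h j)"
      using rotate_to_norm[OF i(2) j(2)] by blast
    define k where "k = h(i := a, j := b)"
    have k: "k i = a" "k j = b" "\<And>l. l \<in> I - {i} - {j} \<Longrightarrow> k l = h l"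
      using False by (auto simp: k_def)
    have split_real: "sum f I = (f i + f j) + sum f (I - {i} - {j})" for f :: "_ \<Rightarrow> real"
      using Suc.prems(1) i(1) j(1) False sum.remove[of I i f] sum.remove[of "I - {i}" j f]
      by (simp add: add.assoc)
    have split_vec: "sum f I = (f i + f j) + sum f (I - {i} - {j})" for f :: "_ \<Rightarrow> 'v"
      using Suc.prems(1) i(1) j(1) False sum.remove[of I i f] sum.remove[of "I - {i}" j f]
      by (simp add: add.assoc)
    show ?thesis
    proof (intro exI[of _ k] conjI allI)
      show "(vnorm ip (k i))\<^sup>2 = t"
        by (simp add: k ab)
      show "(\<Sum>l\<in>I. (vnorm ip (k l))\<^sup>2) = (\<Sum>l\<in>I. (vnorm ip (h l))\<^sup>2)"
        unfolding split_real by (simp only: k(1,2) ab(2)) (simp add: k(3))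
      show "(\<Sum>l\<in>I. smul (ip x (k l)) (k l)) = (\<Sum>l\<in>I. smul (ip x (h l)) (h l))" for x
        unfolding split_vec by (simp only: k(1,2) ab(3)) (simp add: k(3))
    qed
  qed
  then obtain k where k: "(vnorm ip (k i))\<^sup>2 = t"
    "(\<Sum>l\<in>I. (vnorm ip (k l))\<^sup>2) = (\<Sum>l\<in>I. (vnorm ip (h l))\<^sup>2)"
    "\<And>x. (\<Sum>l\<in>I. smul (ip x (k l)) (k l)) = (\<Sum>l\<in>I. smul (ip x (h l)) (h l))"
    by blast
  have "(\<Sum>l\<in>I - {i}. (vnorm ip (k l))\<^sup>2) = of_nat (card (I - {i})) * t"
  proof -
    have "(\<Sum>l\<in>I. (vnorm ip (k l))\<^sup>2) = t + (\<Sum>l\<in>I - {i}. (vnorm ip (k l))\<^sup>2)"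
      using sum.remove[OF Suc.prems(1) i(1), of "\<lambda>l. (vnorm ip (k l))\<^sup>2"] k(1) by simp
    moreover have "card I = Suc (card (I - {i}))"
      using card_Suc_Diff1[OF Suc.prems(1) i(1)] by simp
    ultimately show ?thesis
      using Suc.prems(2) k(2) by (simp add: algebra_simps)
  qed
  moreover have "m = card (I - {i})" "finite (I - {i})"
    using Suc.hyps(2) Suc.prems(1) i(1) by simp_all
  ultimately obtain g where g: "\<And>l. l \<in> I - {i} \<Longrightarrow> (vnorm ip (g l))\<^sup>2 = t"
    "\<And>x. (\<Sum>l\<in>I - {i}. smul (ip x (g l)) (g l)) = (\<Sum>l\<in>I - {i}. smul (ip x (k l)) (k l))"
    using Suc.hyps(1)[of "I - {i}" k] by blast
  show ?case
  proof (intro exI[of _ "g(i := k i)"] conjI ballI allI)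
    show "(vnorm ip ((g(i := k i)) l))\<^sup>2 = t" if "l \<in> I" for l
      using that g(1) k(1) by simp
    show "(\<Sum>l\<in>I. smul (ip x ((g(i := k i)) l)) ((g(i := k i)) l))
        = (\<Sum>l\<in>I. smul (ip x (h l)) (h l))" for x
      unfolding k(3)[symmetric] sum.remove[OF Suc.prems(1) i(1)]
      by (simp add: g(2)[symmetric])
  qed
qed

end


section \<open>Finite dimension\<close>

context hilbert_space_dim
begin

lemma finite_basis: "is_basis smul B \<Longrightarrow> finite B"
  using dimension independent_span_bound unfolding is_basis_def by (metis subset_UNIV)

lemma ip_adj:
  assumes "Vector_Spaces.linear smul smul T"
  shows "ip (T x) y = ip x (adj ip T y)"
proof -
  interpret T: Vector_Spaces.linear smul smul T by fact
  obtain B where B: "finite B" "span B = UNIV"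
    using dimension by (auto simp: is_basis_def)
  have "\<exists>z. \<forall>x. ip (T x) y = ip x z" for y
  proof -
    have "Vector_Spaces.linear smul (*) (\<lambda>x. ip (T x) y)"
      by (rule Vector_Spaces.linear.intro[OF vector_space_axioms vector_space_mult])
         (unfold_locales, simp_all add: T.add T.scale add_left smul_left)
    from Riesz_on_span[OF B(1) this] show ?thesis
      by (auto simp: B(2))
  qed
  then have "\<exists>S. \<forall>x y. ip (T x) y = ip x (S y)"
    by metis
  then have "\<forall>x y. ip (T x) y = ip x (adj ip T y)"
    unfolding adj_def by (rule someI_ex)
  then show ?thesis
    by blast
qed

lemma psd_if_positive_op: "positive_op smul ip T \<Longrightarrow> psd T"
  using ip_adj[of T] by (auto simp: positive_op_def bounded_op_def psd_def)

text \<open>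
  Expand \<open>f\<^sub>i\<close> in the basis \<open>B\<close> that defines the trace: the diagonal entries of the operator are
  \<open>\<Sum>\<^sub>i \<langle>b, g\<^sub>i\<rangle> (f\<^sub>i)\<^sub>b\<close>, and their sum over \<open>b \<in> B\<close> reassembles \<open>f\<^sub>i\<close> in the first argument of
  \<open>\<langle>f\<^sub>i, g\<^sub>i\<rangle>\<close>.
\<close>

lemma op_trace_dual_pair:
  assumes "\<And>x. T x = (\<Sum>i\<in>I. smul (ip x (G i)) (F i))"
  shows "op_trace smul T = (\<Sum>i\<in>I. ip (F i) (G i))"
proof -
  define B where "B = (SOME B. is_basis smul B)"
  have "is_basis smul B"
    unfolding B_def using dimension by (metis someI_ex)
  then have B: "independent B" "span B = UNIV" "finite B"
    using finite_basis by (auto simp: is_basis_def)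
  have rep: "representation B (T b) b = (\<Sum>i\<in>I. ip b (G i) * representation B (F i) b)" for b
    unfolding assms using B by (simp add: representation_sum representation_scale)
  have "op_trace smul T = (\<Sum>b\<in>B. representation B (T b) b)"
    by (simp add: op_trace_def B_def Let_def)
  also have "\<dots> = (\<Sum>i\<in>I. \<Sum>b\<in>B. ip (smul (representation B (F i) b) b) (G i))"
    unfolding rep by (subst sum.swap) (simp add: smul_left mult.commute)
  also have "\<dots> = (\<Sum>i\<in>I. ip (F i) (G i))"
    unfolding sum_left[symmetric] using B by (simp add: sum_representation_eq)
  finally show ?thesis .
qed

text \<open>
  The basis vectors are among \<open>b 1, \<dots>, b N\<close>, and \<open>N\<close> eliminations leave an operator that annihilates
  all of these.
\<close>

lemma psd_rank_one_sum:
  assumes "psd T" "n \<le> N"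
  obtains h where "\<And>x. T x = (\<Sum>i=1..N. smul (ip x (h i)) (h i))"
proof -
  obtain B where B: "is_basis smul B" "finite B" "card B = n"
    using dimension by blast
  obtain b where "bij_betw b {1..n} B"
    using ex_bij_betw_nat_finite_1[OF B(2)] B(3) by blast
  then have b: "B \<subseteq> b ` {1..N}"
    using assms(2) by (auto simp: bij_betw_def)
  obtain h where h: "psd (\<lambda>x. T x - (\<Sum>i=1..N. smul (ip x (h i)) (h i)))"
    "\<And>j. j \<in> {1..N} \<Longrightarrow> T (b j) - (\<Sum>i=1..N. smul (ip (b j) (h i)) (h i)) = 0"
    using psd_elimination_iterated[OF assms(1), of N b] by blast
  interpret R: Vector_Spaces.linear smul smul "\<lambda>x. T x - (\<Sum>i=1..N. smul (ip x (h i)) (h i))"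
    using h(1) by (simp add: psd_def)
  show thesis
  proof
    fix x
    have "T x - (\<Sum>i=1..N. smul (ip x (h i)) (h i)) = 0"
    proof (rule R.eq_0_on_span)
      show "T x - (\<Sum>i=1..N. smul (ip x (h i)) (h i)) = 0" if "x \<in> B" for x
        using that b h(2) by blast
      show "x \<in> span B"
        using B(1) by (simp add: is_basis_def)
    qed
    then show "T x = (\<Sum>i=1..N. smul (ip x (h i)) (h i))"
      by simp
  qed
qed

text \<open>
  For \<open>F = G = h\<close> the frame sum is \<open>\<langle>K f, f\<rangle>\<close>, and \<open>\<parallel>K f\<parallel>\<^sup>2 \<le> \<parallel>K\<parallel> \<langle>K f, f\<rangle>\<close> by Cauchy-Schwarz for the
  form \<open>\<langle>K x, y\<rangle>\<close>.
\<close>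

lemma K_dual_pair_self:
  assumes K: "positive_op smul ip K"
    and h: "\<And>x. K x = (\<Sum>i=1..N. smul (ip x (h i)) (h i))"
  shows "K_dual_pair smul ip K N h h"
proof -
  interpret form: semidefinite_form smul "\<lambda>x y. ip (K x) y"
    by (rule psd_form[OF psd_if_positive_op[OF K]])
  have adj: "adj ip K = K"
    using K by (simp add: positive_op_def)
  obtain C where C: "\<And>x. vnorm ip (K x) \<le> C * vnorm ip x"
    using K by (auto simp: positive_op_def bounded_op_def)
  \<comment> \<open>The frame bounds will be \<open>1 / D\<close> and \<open>D\<close>; they must be positive and in this order, hence \<open>D \<ge> 1\<close>.\<close>
  define D where "D = max 1 C"
  have D: "D > 0" "vnorm ip (K x) \<le> D * vnorm ip x" for x
    using order_trans[OF C mult_right_mono[of C D]] by (auto simp: D_def)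
  have sum: "(\<Sum>i=1..N. (norm (ip x (h i)))\<^sup>2) = norm (ip (K x) x)" for x
  proof -
    have "ip (K x) x = (\<Sum>i=1..N. ip x (h i) * conjg (ip x (h i)))"
      unfolding h sum_left smul_left by (intro sum.cong refl) (metis commute)
    also have "\<dots> = of_real (\<Sum>i=1..N. (norm (ip x (h i)))\<^sup>2)"
      by (simp add: mult_conjg_of_real)
    finally show ?thesis
      by (simp only: norm_of_real) (simp add: sum_nonneg)
  qed
  have lower: "(vnorm ip (K x))\<^sup>2 \<le> D * norm (ip (K x) x)" for x
  proof (cases "K x = 0")
    case False
    then have pos: "(vnorm ip (K x))\<^sup>2 > 0"
      by simp
    have "((vnorm ip (K x))\<^sup>2)\<^sup>2 \<le> norm (ip (K x) x) * norm (ip (K (K x)) (K x))"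
      using form.Cauchy_Schwarz[of x "K x"] by (simp add: vnorm_sq)
    also have "\<dots> \<le> norm (ip (K x) x) * (D * (vnorm ip (K x))\<^sup>2)"
    proof (rule mult_left_mono)
      have "norm (ip (K (K x)) (K x)) \<le> vnorm ip (K (K x)) * vnorm ip (K x)"
        by (rule norm_ip_le)
      also have "\<dots> \<le> D * vnorm ip (K x) * vnorm ip (K x)"
        by (intro mult_right_mono D) simp
      finally show "norm (ip (K (K x)) (K x)) \<le> D * (vnorm ip (K x))\<^sup>2"
        by (simp add: power2_eq_square)
    qed simp
    finally have "(vnorm ip (K x))\<^sup>2 * (vnorm ip (K x))\<^sup>2
        \<le> (D * norm (ip (K x) x)) * (vnorm ip (K x))\<^sup>2"
      by (simp add: power2_eq_square algebra_simps)
    then show ?thesis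
      using pos by (rule mult_right_le_imp_le)
  qed (use D(1) in simp)
  have upper: "norm (ip (K x) x) \<le> D * (vnorm ip x)\<^sup>2" for x
    using order_trans[OF norm_ip_le[of "K x" x] mult_right_mono[OF D(2)[of x] vnorm_nonneg[of x]]]
    by (simp add: power2_eq_square mult.assoc)
  have "K_frame ip K N h"
    unfolding K_frame_def adj sum
  proof (intro exI conjI allI)
    show "0 < 1 / D" "1 / D \<le> D"
      using D(1) by (simp_all add: field_simps) (simp add: D_def mult_ge1_I)
    show "1 / D * (vnorm ip (K x))\<^sup>2 \<le> norm (ip (K x) x)" for x
      using lower[of x] D(1) by (simp add: field_simps)
    show "norm (ip (K x) x) \<le> D * (vnorm ip x)\<^sup>2" for x
      by (rule upper)
  qed
  then show ?thesis
    using h unfolding K_dual_pair_def by blast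
qed

lemma erasure_error_eq:
  "erasure_error smul ip N F G = Max ((\<lambda>i. vnorm ip (F i) * vnorm ip (G i)) ` {1..N})"
  by (simp only: erasure_error_def op_norm_rank_one)

lemma le_sum_vnorm_if_trace:
  assumes "K_dual_pair smul ip K N F G" "op_trace smul K = of_real t"
  shows "t \<le> (\<Sum>i=1..N. vnorm ip (F i) * vnorm ip (G i))"
proof -
  have "K x = (\<Sum>i=1..N. smul (ip x (G i)) (F i))" for x
    using assms(1) unfolding K_dual_pair_def by blast
  from op_trace_dual_pair[OF this] have "of_real t = (\<Sum>i=1..N. ip (F i) (G i))"
    by (simp only: assms(2))
  then have "\<bar>t\<bar> = norm (\<Sum>i=1..N. ip (F i) (G i))"
    by (metis norm_of_real)
  also have "\<dots> \<le> (\<Sum>i=1..N. vnorm ip (F i) * vnorm ip (G i))"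
    by (intro sum_norm_le norm_ip_le)
  finally show ?thesis
    by simp
qed

end


section \<open>Optimal dual pairs\<close>

lemma mean_le_Max:
  fixes a :: "nat \<Rightarrow> real"
  assumes "1 \<le> N" "t \<le> (\<Sum>i=1..N. a i)"
  shows "t / N \<le> Max (a ` {1..N})"
proof -
  have "(\<Sum>i=1..N. a i) \<le> (\<Sum>i=1..N. Max (a ` {1..N}))"
    by (intro sum_mono) simp
  then show ?thesis
    using assms by (simp add: field_simps)
qed

lemma Max_eq_mean_iff:
  fixes a :: "nat \<Rightarrow> real"
  assumes "1 \<le> N" "t \<le> (\<Sum>i=1..N. a i)"
  shows "Max (a ` {1..N}) = t / N \<longleftrightarrow> (\<forall>i\<in>{1..N}. a i = t / N)"
proof
  assume max: "Max (a ` {1..N}) = t / N"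
  have le: "a i \<le> t / N" if "i \<in> {1..N}" for i
    unfolding max[symmetric] using that by simp
  show "\<forall>i\<in>{1..N}. a i = t / N"
  proof (rule ccontr)
    assume "\<not> ?thesis"
    then obtain i where "i \<in> {1..N}" "a i < t / N"
      using le by fastforce
    then have "(\<Sum>i=1..N. a i) < (\<Sum>i=1..N. t / N)"
      using le by (intro sum_strict_mono_ex1) auto
    then show False
      using assms by simp
  qed
next
  assume "\<forall>i\<in>{1..N}. a i = t / N"
  then have "a ` {1..N} = {t / N}"
    using assms(1) by auto
  then show "Max (a ` {1..N}) = t / N"
    by simp
qed

theorem proposition3p4:
  fixes smul :: "'k::rc_field \<Rightarrow> 'v::ab_group_add \<Rightarrow> 'v"
    and ip :: "'v \<Rightarrow> 'v \<Rightarrow> 'k"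
    and K :: "'v \<Rightarrow> 'v"
    and n N :: nat
  assumes "hilbert_space_dim smul ip n"
    and "n \<le> N" and "1 \<le> N"
    and "positive_op smul ip K"
  shows "of_real (min_erasure_error smul ip K N) = op_trace smul K / of_nat N
    \<and> (\<forall>F G. K_dual_pair smul ip K N F G \<longrightarrow>
          (erasure_optimal smul ip K N F G \<longleftrightarrow>
             (\<forall>i\<in>{1..N}. of_real (vnorm ip (F i) * vnorm ip (G i)) = op_trace smul K / of_nat N)))"
proof -
  interpret hilbert_space_dim smul ip n by fact
  obtain h where h: "\<And>x. K x = (\<Sum>i=1..N. smul (ip x (h i)) (h i))"
    using psd_rank_one_sum[OF psd_if_positive_op[OF assms(4)] assms(2)] by blast
  define t where "t = (\<Sum>i=1..N. (vnorm ip (h i))\<^sup>2)"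
  have trace: "op_trace smul K = of_real t"
    using op_trace_dual_pair[OF h] by (simp add: ip_self t_def)
  have sum_t: "(\<Sum>i\<in>{1..N}. (vnorm ip (h i))\<^sup>2) = of_nat (card {1..N}) * (t / N)"
    using assms(3) by (simp add: t_def)
  obtain g where g: "\<And>i. i \<in> {1..N} \<Longrightarrow> (vnorm ip (g i))\<^sup>2 = t / N"
    "\<And>x. (\<Sum>i\<in>{1..N}. smul (ip x (g i)) (g i)) = (\<Sum>i\<in>{1..N}. smul (ip x (h i)) (h i))"
    using equal_norm_rank_one_sum[OF finite_atLeastAtMost sum_t] by blast
  have dual: "K_dual_pair smul ip K N g g"
    by (rule K_dual_pair_self[OF assms(4)]) (simp only: h g(2))
  have error_g: "erasure_error smul ip N g g = t / N"
    unfolding erasure_error_eq Max_eq_mean_iff[OF assms(3) le_sum_vnorm_if_trace[OF dual trace]]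
    using g(1) by (simp add: power2_eq_square)
  have min: "min_erasure_error smul ip K N = t / N"
    unfolding min_erasure_error_def
  proof (rule cInf_eq_minimum)
    show "t / N \<in> {erasure_error smul ip N F G |F G. K_dual_pair smul ip K N F G}"
      using dual error_g by force
    fix r assume "r \<in> {erasure_error smul ip N F G |F G. K_dual_pair smul ip K N F G}"
    then show "t / N \<le> r"
      using mean_le_Max[OF assms(3) le_sum_vnorm_if_trace[OF _ trace]]
      by (auto simp: erasure_error_eq)
  qed
  have quotient: "op_trace smul K / of_nat N = of_real (t / N)"
    by (simp add: trace)
  have "erasure_optimal smul ip K N F G \<longleftrightarrow> (\<forall>i\<in>{1..N}. vnorm ip (F i) * vnorm ip (G i) = t / N)"
    if "K_dual_pair smul ip K N F G" for F G
    using that Max_eq_mean_iff[OF assms(3) le_sum_vnorm_if_trace[OF that trace]]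
    by (simp add: erasure_optimal_def min erasure_error_eq)
  then show ?thesis
    unfolding quotient of_real_eq_iff min by blast
qed

end
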